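(* Let $\mathcal{M}$ be an interactive mechanism answering linear queries that is $(\varepsilon,\delta,\kappa)$-partial differentially private and $(\alpha,\beta)$-sample accurate. Suppose further that each query $q_t$ depends on at most $\hat m$ data points. Then for every data distribution $\mathcal{P}$, every adversary $\mathcal{A}$, and all constants $c,d>0$, $$\Pr_{S\sim\mathcal{P}^m,\ \Pi\sim I(\mathcal{M},\mathcal{A};S)}\left[\max_t\left|a_t-q_t(\mathcal{P}^m)\right|>\alpha+\frac{\hat m}{m}(e^\varepsilon-1+c)+\frac{2\kappa}{m}+2d\right]\le\frac{\delta}{d}+\frac{\beta}{c}.$$
   Context: Setting. A dataset $S\in\mathcal{X}^m$ is held by a mechanism $\mathcal{M}$, where $\mathcal{X}$ is countable. An adversary $\mathcal{A}$ interacts with $\mathcal{M}$: at each step $t$ the adversary chooses a query $q_t$ depending on the interaction so far, and $\mathcal{M}$ returns an answer $a_t\in\mathbb{R}$. The transcript is a random variable $\Pi$ with values in the space of transcripts $\mathbf{\Pi}$, with distribution $I(\mathcal{M},\mathcal{A};S)$. Linear queries. A linear query is $q(S)=\frac1m\sum_i q_i(S_i)$ with $q_i:\mathcal{X}\to[0,1]$. "$q_t$ depends on at most $\hat m$ data points" means there is a set of at most $\hat m$ indices (possibly depending on the transcript) such that $q_t(S)$ is determined by the coordinates of $S$ in that set. For a distribution $\mathcal{P}$ on $\mathcal{X}$, $q(\mathcal{P}^m)=\mathbb{E}_{S\sim\mathcal{P}^m}[q(S)]$. Partial differential privacy. $\mathcal{M}$ is $(\varepsilon,\delta,\kappa)$-partial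 differentially private if there is a map $f_L:\mathbf{\Pi}\to2^{[m]}$ with $\max_\pi|f_L(\pi)|\le\kappa$ such that the following holds. For every adversary $\mathcal{A}$, every index $i$, every pair $S,S'$ differing only in position $i$, and every event $E\subseteq\mathbf{\Pi}$ with $i\notin\bigcup_{\pi\in E}f_L(\pi)$, $$\Pr_{I(\mathcal{M},\mathcal{A};S)}[\Pi\in E]\le e^\varepsilon\Pr_{I(\mathcal{M},\mathcal{A};S')}[\Pi\in E]+\delta.$$ Sample accuracy. $\mathcal{M}$ is $(\alpha,\beta)$-sample accurate if $$\Pr_{S\sim\mathcal{P}^m,\ \Pi\sim I(\mathcal{M},\mathcal{A};S)}\left[\max_t|a_t-q_t(S)|\ge\alpha\right]\le\beta.$$
   Formalization: The bound is proved with β/min(1,c) instead of β/c; for c>1 the stated bound fails (constant query 0, answers 0 or 100 with probability 1/2 each, c=4, d=1). Also ε≥0 is assumed and the map f_L is required to be measurable. *)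

theory Defs
  imports "HOL-Probability.Probability"
begin

text \<open>
  A dataset of size \<open>m\<close> is a function \<open>'i \<Rightarrow> 'x\<close>, where the finite type \<open>'i\<close> of positions plays the
  role of the index set \<open>[m]\<close> (so \<open>m = CARD('i)\<close>) and \<open>'x\<close> is the countable data universe.
  A linear query is given by its components \<open>q i :: 'x \<Rightarrow> real\<close>.
\<close>

type_synonym ('i, 'x) query = "'i \<Rightarrow> 'x \<Rightarrow> real"

definition linear_queries :: "('i, 'x) query set" where
  "linear_queries = {q. \<forall>i x. 0 \<le> q i x \<and> q i x \<le> 1}"

definition query_value :: "('i::finite, 'x) query \<Rightarrow> ('i \<Rightarrow> 'x) \<Rightarrow> real" where
  "query_value q S = (\<Sum>i\<in>UNIV. q i (S i)) / real CARD('i)"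

definition determined_by :: "(('i \<Rightarrow> 'x) \<Rightarrow> real) \<Rightarrow> 'i set \<Rightarrow> bool" where
  "determined_by F J \<longleftrightarrow> (\<forall>S S'. (\<forall>i\<in>J. S i = S' i) \<longrightarrow> F S = F S')"

definition depends_on_at_most :: "nat \<Rightarrow> ('i::finite, 'x) query \<Rightarrow> bool" where
  "depends_on_at_most k q \<longleftrightarrow> (\<exists>J. card J \<le> k \<and> determined_by (query_value q) J)"

text \<open>The i.i.d. sample; the default value of \<^const>\<open>Pi_pmf\<close> is irrelevant on \<open>UNIV\<close>.\<close>

definition iid_sample :: "'x pmf \<Rightarrow> ('i::finite \<Rightarrow> 'x) pmf" where
  "iid_sample P = Pi_pmf UNIV undefined (\<lambda>_. P)"

definition population_value :: "'x pmf \<Rightarrow> ('i::finite, 'x) query \<Rightarrow> real" where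
  "population_value P q = measure_pmf.expectation (iid_sample P) (query_value q)"

text \<open>
  Queries are taken from a class \<open>Q\<close>. As positions and universe are countable, the Borel sets of
  the product topology used here are the product \<open>\<sigma>\<close>-algebra. A transcript of \<open>t\<close> rounds is a
  family of query/answer pairs indexed by \<open>{..<t}\<close>.
\<close>

definition query_space :: "('i::finite, 'x::countable) query set \<Rightarrow> ('i, 'x) query measure" where
  "query_space Q = restrict_space borel Q"

type_synonym ('i, 'x) transcript = "nat \<Rightarrow> ('i, 'x) query \<times> real"

definition transcript_space ::
  "('i::finite, 'x::countable) query set \<Rightarrow> nat \<Rightarrow> ('i, 'x) transcript measure" where
  "transcript_space Q t = (\<Pi>\<^sub>M j\<in>{..<t}. query_space Q \<Otimes>\<^sub>M borel)"

text \<open>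
  An interactive mechanism is a randomized algorithm with a hidden internal state: the dataset
  determines the distribution of the initial state, and each query is answered by a real number
  drawn jointly with the next state.
\<close>

record ('i, 'x, 's) mechanism =
  states :: "'s measure"
  init :: "('i \<Rightarrow> 'x) \<Rightarrow> 's measure"
  respond :: "'s \<Rightarrow> ('i, 'x) query \<Rightarrow> (real \<times> 's) measure"

definition is_mechanism ::
  "('i::finite, 'x::countable) query set \<Rightarrow> ('i, 'x, 's) mechanism \<Rightarrow> bool" where
  "is_mechanism Q M \<longleftrightarrow>
     (\<forall>S. init M S \<in> space (prob_algebra (states M))) \<and>
     (\<lambda>(s, q). respond M s q) \<in>
       states M \<Otimes>\<^sub>M query_space Q \<rightarrow>\<^sub>M prob_algebra (borel \<Otimes>\<^sub>M states M)"

text \<open>\<open>A t h\<close> is the (possibly randomized) choice of the next query after the \<open>t\<close>-round history \<open>h\<close>.\<close>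

type_synonym ('i, 'x) adversary = "nat \<Rightarrow> ('i, 'x) transcript \<Rightarrow> ('i, 'x) query measure"

definition is_adversary ::
  "('i::finite, 'x::countable) query set \<Rightarrow> nat \<Rightarrow> ('i, 'x) adversary \<Rightarrow> bool" where
  "is_adversary Q T A \<longleftrightarrow> (\<forall>t<T. A t \<in> transcript_space Q t \<rightarrow>\<^sub>M prob_algebra (query_space Q))"

primrec run ::
  "('i::finite, 'x::countable) query set \<Rightarrow> ('i, 'x, 's) mechanism \<Rightarrow> ('i, 'x) adversary \<Rightarrow>
    ('i \<Rightarrow> 'x) \<Rightarrow> nat \<Rightarrow> (('i, 'x) transcript \<times> 's) measure" where
  "run Q M A S 0 =
     do { s \<leftarrow> init M S; return (transcript_space Q 0 \<Otimes>\<^sub>M states M) (\<lambda>_. undefined, s) }"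
| "run Q M A S (Suc t) =
     do { (h, s) \<leftarrow> run Q M A S t;
          q \<leftarrow> A t h;
          (a, s') \<leftarrow> respond M s q;
          return (transcript_space Q (Suc t) \<Otimes>\<^sub>M states M) (h(t := (q, a)), s') }"

text \<open>The distribution \<open>I(M, A; S)\<close> of the transcript of a \<open>T\<close>-round interaction.\<close>

definition interaction ::
  "('i::finite, 'x::countable) query set \<Rightarrow> nat \<Rightarrow> ('i, 'x, 's) mechanism \<Rightarrow> ('i, 'x) adversary \<Rightarrow>
    ('i \<Rightarrow> 'x) \<Rightarrow> ('i, 'x) transcript measure" where
  "interaction Q T M A S = distr (run Q M A S T) (transcript_space Q T) fst"

text \<open>The joint distribution of \<open>S \<sim> P\<^sup>m\<close> and \<open>\<Pi> \<sim> I(M, A; S)\<close>.\<close>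

definition sample_and_transcript ::
  "('i::finite, 'x::countable) query set \<Rightarrow> nat \<Rightarrow> ('i, 'x, 's) mechanism \<Rightarrow> ('i, 'x) adversary \<Rightarrow>
    'x pmf \<Rightarrow> (('i \<Rightarrow> 'x) \<times> ('i, 'x) transcript) measure" where
  "sample_and_transcript Q T M A P =
     do { S \<leftarrow> measure_pmf (iid_sample P);
          \<pi> \<leftarrow> interaction Q T M A S;
          return (count_space UNIV \<Otimes>\<^sub>M transcript_space Q T) (S, \<pi>) }"

definition differ_only_at :: "'i \<Rightarrow> ('i \<Rightarrow> 'x) \<Rightarrow> ('i \<Rightarrow> 'x) \<Rightarrow> bool" where
  "differ_only_at i S S' \<longleftrightarrow> (\<forall>j. j \<noteq> i \<longrightarrow> S j = S' j)"

text \<open>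
  The map \<open>f\<^sub>L\<close> has to be measurable: otherwise the sets \<open>{\<pi>. i \<notin> f\<^sub>L \<pi>}\<close> need not contain any
  non-null event, and the condition could be void.
\<close>

definition partial_differentially_private ::
  "('i::finite, 'x::countable) query set \<Rightarrow> nat \<Rightarrow> ('i, 'x, 's) mechanism \<Rightarrow>
    real \<Rightarrow> real \<Rightarrow> nat \<Rightarrow> bool" where
  "partial_differentially_private Q T M \<epsilon> \<delta> \<kappa> \<longleftrightarrow>
     (\<exists>f\<^sub>L :: ('i, 'x) transcript \<Rightarrow> 'i set.
        f\<^sub>L \<in> transcript_space Q T \<rightarrow>\<^sub>M count_space UNIV \<and>
        (\<forall>\<pi>\<in>space (transcript_space Q T). card (f\<^sub>L \<pi>) \<le> \<kappa>) \<and>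
        (\<forall>A i S S' E.
           is_adversary Q T A \<longrightarrow> differ_only_at i S S' \<longrightarrow>
           E \<in> sets (transcript_space Q T) \<longrightarrow> i \<notin> (\<Union>\<pi>\<in>E. f\<^sub>L \<pi>) \<longrightarrow>
           measure (interaction Q T M A S) E
             \<le> exp \<epsilon> * measure (interaction Q T M A S') E + \<delta>))"

definition sample_accurate ::
  "('i::finite, 'x::countable) query set \<Rightarrow> nat \<Rightarrow> ('i, 'x, 's) mechanism \<Rightarrow> real \<Rightarrow> real \<Rightarrow> bool" where
  "sample_accurate Q T M \<alpha> \<beta> \<longleftrightarrow>
     (\<forall>A P. is_adversary Q T A \<longrightarrow>
        \<P>((S, \<pi>) in sample_and_transcript Q T M A P.
          (MAX t\<in>{..<T}. \<bar>snd (\<pi> t) - query_value (fst (\<pi> t)) S\<bar>) \<ge> \<alpha>) \<le> \<beta>)"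

end

theory Submission
  imports Defs
begin

text \<open>
  Bayes' rule for the countable sample space gives a posterior distribution of the dataset for each
  transcript \<open>\<pi>\<close>, and the joint distribution can be generated by drawing \<open>\<pi>\<close> first and the dataset from
  the posterior. If the posterior probability of a sample error \<open>\<ge> \<alpha>\<close> is below \<open>min 1 c\<close>, then each
  answer is within \<open>\<alpha> + (m'/m) c\<close> of the posterior expectation of its query; by Markov this fails with
  probability at most \<open>\<beta> / min 1 c\<close>.

  Let \<open>p\<^sub>i\<close> be the posterior marginal at position \<open>i\<close>. Privacy, applied for each \<open>x\<close> to the event
  \<open>i \<notin> f\<^sub>L \<pi> \<and> p\<^sub>i(x) > e\<^sup>\<epsilon> P(x)\<close>, bounds the expectation of the hockey-stick divergence
  \<open>\<Sum>x. max 0 (p\<^sub>i(x) - e\<^sup>\<epsilon> P(x))\<close>, restricted to \<open>i \<notin> f\<^sub>L \<pi>\<close>, by \<open>\<delta>\<close>. By Markov the average of these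
  divergences over \<open>i\<close> is below \<open>d\<close> except with probability \<open>\<delta> / d\<close>. It controls the distance between posterior
  and population value simultaneously for all queries and in both directions: a position outside
  \<open>f\<^sub>L \<pi>\<close> contributes \<open>e\<^sup>\<epsilon> - 1\<close> plus its divergence, one in \<open>f\<^sub>L \<pi>\<close> at most \<open>1\<close>, and one on which
  the query does not depend nothing.
\<close>

subsection \<open>Posterior distributions for a countable prior\<close>

lemma bind_in_space_prob_algebra:
  assumes "K \<in> space (prob_algebra L)" "f \<in> L \<rightarrow>\<^sub>M prob_algebra N"
  shows "K \<bind> f \<in> space (prob_algebra N)"
  using prob_space_bind'[OF assms] sets_bind'[OF assms] by (simp add: space_prob_algebra)

lemma borel_measurable_nn_integral_count_space:
  fixes f :: "'a::countable \<Rightarrow> 'b \<Rightarrow> ennreal"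
  assumes "\<And>x. f x \<in> borel_measurable N"
  shows "(\<lambda>y. \<integral>\<^sup>+x. f x y \<partial>count_space UNIV) \<in> borel_measurable N"
proof -
  interpret sigma_finite_measure "count_space (UNIV :: 'a set)"
    by (rule sigma_finite_measure_count_space_countable) simp
  have [measurable]: "(\<lambda>(x, y). f x y) \<in> borel_measurable (count_space UNIV \<Otimes>\<^sub>M N)"
    using assms by (intro measurable_pair_measure_countable1) auto
  have "(\<lambda>(y, x). f x y) \<in> borel_measurable (N \<Otimes>\<^sub>M count_space UNIV)"
    by measurable
  then show ?thesis
    by (rule borel_measurable_nn_integral)
qed

text \<open>The probability is a countable sum of point masses times indicators. It serves posterior
  probabilities of events that vary with the transcript: \<open>G x\<close> is the section at
  \<open>x\<close> of a joint event.\<close>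

lemma borel_measurable_emeasure_pmf_section:
  fixes q :: "'b \<Rightarrow> 'a::countable pmf"
  assumes [measurable]: "\<And>x. (\<lambda>y. pmf (q y) x) \<in> borel_measurable N" "\<And>x. G x \<in> sets N"
  shows "(\<lambda>y. emeasure (measure_pmf (q y)) {x. y \<in> G x}) \<in> borel_measurable N"
proof -
  have "emeasure (measure_pmf (q y)) {x. y \<in> G x}
      = (\<integral>\<^sup>+x. ennreal (pmf (q y) x) * indicator (G x) y \<partial>count_space UNIV)" for y
  proof -
    have "emeasure (measure_pmf (q y)) {x. y \<in> G x} = (\<integral>\<^sup>+x. indicator {x. y \<in> G x} x \<partial>q y)"
      by simp
    then show ?thesis
      by (simp only: nn_integral_measure_pmf) (simp add: indicator_def)
  qed
  then show ?thesis
    by (simp add: borel_measurable_nn_integral_count_space)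
qed

lemma (in finite_measure) measure_markov:
  assumes f: "f \<in> borel_measurable M" and "(\<integral>\<^sup>+x. f x \<partial>M) \<le> ennreal b" and "a > 0" "b \<ge> 0"
  shows "measure M {x \<in> space M. ennreal a \<le> f x} \<le> b / a"
proof -
  have a: "ennreal (1 / a) * ennreal a = 1"
    using \<open>a > 0\<close> by (simp add: ennreal_mult[symmetric] del: ennreal_1 flip: ennreal_1)
  have "{x \<in> space M. ennreal a \<le> f x} \<subseteq> {x \<in> space M. 1 \<le> ennreal (1 / a) * f x}"
  proof clarify
    fix x assume "ennreal a \<le> f x"
    then have "ennreal (1 / a) * ennreal a \<le> ennreal (1 / a) * f x"
      by (rule mult_left_mono) simp
    then show "1 \<le> ennreal (1 / a) * f x" by (simp only: a)
  qed
  then have "emeasure M {x \<in> space M. ennreal a \<le> f x} \<le> emeasure M {x \<in> space M. 1 \<le> ennreal (1 / a) * f x}"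
    using f by (intro emeasure_mono) measurable
  also have "\<dots> \<le> ennreal (1 / a) * (\<integral>\<^sup>+x. f x * indicator (space M) x \<partial>M)"
    using f by (intro nn_integral_Markov_inequality) auto
  also have "(\<integral>\<^sup>+x. f x * indicator (space M) x \<partial>M) = (\<integral>\<^sup>+x. f x \<partial>M)"
    by (rule nn_integral_cong) simp
  also have "ennreal (1 / a) * \<dots> \<le> ennreal (1 / a) * ennreal b"
    using assms(2) by (rule mult_left_mono) simp
  also have "\<dots> = ennreal (b / a)"
    using assms by (simp add: ennreal_mult[symmetric])
  finally show ?thesis
    using assms by (simp add: emeasure_eq_measure)
qed

text \<open>Each measure \<open>K x\<close>, scaled by \<open>pmf p x\<close>, is dominated by the
  mixture, so Radon-Nikodym supplies a density for every \<open>x\<close>. Countably many densities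
  can be summed, and almost everywhere they sum to 1 and form a pmf. Countability of the conditioned
  variable replaces any assumption that \<open>N\<close> be standard Borel.\<close>

lemma posterior_exists:
  fixes p :: "'a::countable pmf" and K :: "'a \<Rightarrow> 'b measure"
  assumes K: "\<And>x. K x \<in> space (prob_algebra N)"
  obtains post :: "'b \<Rightarrow> 'a pmf" where
    "\<And>x. (\<lambda>y. pmf (post y) x) \<in> borel_measurable N"
    "\<And>x B. B \<in> sets N \<Longrightarrow> ennreal (pmf p x) * emeasure (K x) B
        = (\<integral>\<^sup>+y\<in>B. ennreal (pmf (post y) x) \<partial>(measure_pmf p \<bind> K))"
proof -
  define \<rho> where "\<rho> = measure_pmf p \<bind> K"
  have Kp: "K \<in> measure_pmf p \<rightarrow>\<^sub>M prob_algebra N"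
    using K by simp
  have sets_K [simp, measurable_cong]: "sets (K x) = sets N" for x
    using K[of x] by (simp add: space_prob_algebra)
  have sets_\<rho> [simp, measurable_cong]: "sets \<rho> = sets N"
    unfolding \<rho>_def by (rule sets_bind[of _ _ N]) auto
  have \<rho>: "emeasure \<rho> B = (\<integral>\<^sup>+x. ennreal (pmf p x) * emeasure (K x) B \<partial>count_space UNIV)"
    if "B \<in> sets N" for B
    using that measurable_prob_algebraD[OF Kp] unfolding \<rho>_def
    by (subst emeasure_bind[where N=N]) (auto simp: nn_integral_measure_pmf)
  interpret R: prob_space \<rho>
    unfolding \<rho>_def using Kp
    by (intro measure_pmf.prob_space_bind[where S=N] AE_I2 measurable_prob_algebraD)
       (use K in \<open>auto simp: space_prob_algebra\<close>)
  define D where "D x = RN_deriv \<rho> (scale_measure (ennreal (pmf p x)) (K x))" for x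
  have D_meas [measurable]: "D x \<in> borel_measurable N" for x
    using borel_measurable_RN_deriv[of \<rho>] unfolding D_def by simp
  have D: "ennreal (pmf p x) * emeasure (K x) B = (\<integral>\<^sup>+y\<in>B. D x y \<partial>\<rho>)" if "B \<in> sets N" for x B
  proof -
    have "absolutely_continuous \<rho> (scale_measure (ennreal (pmf p x)) (K x))"
      unfolding absolutely_continuous_def
    proof
      fix B assume "B \<in> null_sets \<rho>"
      then have "B \<in> sets N" "emeasure \<rho> B = 0" by auto
      \<comment> \<open>On a null set of the mixture a countable sum of nonnegative terms vanishes,
        hence so does each term.\<close>
      then have "ennreal (pmf p x) * emeasure (K x) B = 0"
        by (simp add: \<rho> nn_integral_0_iff_AE AE_count_space)
      then show "B \<in> null_sets (scale_measure (ennreal (pmf p x)) (K x))"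
        using \<open>B \<in> sets N\<close> by (auto simp: null_sets_def)
    qed
    then have "density \<rho> (D x) = scale_measure (ennreal (pmf p x)) (K x)"
      unfolding D_def by (intro R.density_RN_deriv) auto
    from arg_cong[OF this, of "\<lambda>m. emeasure m B"] that show ?thesis
      by (simp add: emeasure_density)
  qed
  define s where "s y = (\<integral>\<^sup>+x. D x y \<partial>count_space UNIV)" for y
  have s_meas [measurable]: "s \<in> borel_measurable N"
    unfolding s_def by (rule borel_measurable_nn_integral_count_space) measurable
  \<comment> \<open>Summing the densities over \<open>x\<close> under the integral returns
    \<open>emeasure \<rho> B\<close> for every \<open>B\<close>, so \<open>s\<close> and 1 are
    densities of the same measure.\<close>
  have s1: "AE y in \<rho>. s y = 1"
  proof (rule R.density_unique)
    show "density \<rho> s = density \<rho> (\<lambda>_. 1)"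
    proof (rule measure_eqI)
      fix B assume "B \<in> sets (density \<rho> s)"
      then have [measurable]: "B \<in> sets N" by simp
      have "emeasure (density \<rho> s) B = (\<integral>\<^sup>+y. (\<integral>\<^sup>+x. D x y * indicator B y \<partial>count_space UNIV) \<partial>\<rho>)"
        by (simp add: emeasure_density s_def nn_integral_multc)
      also have "\<dots> = (\<integral>\<^sup>+x. (\<integral>\<^sup>+y. D x y * indicator B y \<partial>\<rho>) \<partial>count_space UNIV)"
        by (rule nn_integral_count_space_nn_integral) (auto simp: measurable_cong_sets[OF sets_\<rho> refl])
      also have "\<dots> = emeasure (density \<rho> (\<lambda>_. 1)) B"
        by (simp add: D[symmetric] \<rho> density_1)
      finally show "emeasure (density \<rho> s) B = emeasure (density \<rho> (\<lambda>_. 1)) B" .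
    qed simp
  qed measurable
  \<comment> \<open>On the null set where the densities do not sum to 1 the value is immaterial; the
    prior keeps \<open>post\<close> total and its point masses measurable in
    \<open>y\<close>.\<close>
  define post where "post y = (if s y = 1 then embed_pmf (\<lambda>x. enn2real (D x y)) else p)" for y
  have post: "pmf (post y) x = (if s y = 1 then enn2real (D x y) else pmf p x)" 
     and fin: "s y = 1 \<Longrightarrow> ennreal (enn2real (D x y)) = D x y" for x y
  proof -
    have f: "ennreal (enn2real (D x y)) = D x y" if "s y = 1" for x
    proof -
      have "D x y \<le> s y"
        unfolding s_def by (rule nn_integral_ge_point) simp
      with that show ?thesis
        by (intro ennreal_enn2real) (auto simp: top_unique intro: le_less_trans)
    qed
    then show "s y = 1 \<Longrightarrow> ennreal (enn2real (D x y)) = D x y" .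
    show "pmf (post y) x = (if s y = 1 then enn2real (D x y) else pmf p x)"
      by (auto simp: post_def pmf_embed_pmf f s_def[symmetric])
  qed
  show thesis
  proof
    show "(\<lambda>y. pmf (post y) x) \<in> borel_measurable N" for x
      unfolding post by measurable
    show "ennreal (pmf p x) * emeasure (K x) B
        = (\<integral>\<^sup>+y\<in>B. ennreal (pmf (post y) x) \<partial>(measure_pmf p \<bind> K))" if "B \<in> sets N" for x B
      unfolding D[OF that] \<rho>_def[symmetric] using s1
      by (intro nn_integral_cong_AE) (auto simp: post fin)
  qed
qed

text \<open>Tonelli for the sum over \<open>x\<close> and the integral over \<open>y\<close>. With
  \<open>G x\<close> the section at \<open>x\<close> of a joint event, both sides are its
  probability: dataset drawn first on the left, transcript drawn first on the right.\<close>

lemma posterior_joint: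
  fixes p :: "'a::countable pmf" and K :: "'a \<Rightarrow> 'b measure"
  assumes K: "\<And>x. K x \<in> space (prob_algebra N)"
    and meas: "\<And>x. (\<lambda>y. pmf (post y) x) \<in> borel_measurable N"
    and post: "\<And>x B. B \<in> sets N \<Longrightarrow> ennreal (pmf p x) * emeasure (K x) B
        = (\<integral>\<^sup>+y\<in>B. ennreal (pmf (post y) x) \<partial>(measure_pmf p \<bind> K))"
    and G: "\<And>x. G x \<in> sets N"
  shows "(\<integral>\<^sup>+x. emeasure (K x) (G x) \<partial>measure_pmf p)
      = (\<integral>\<^sup>+y. emeasure (measure_pmf (post y)) {x. y \<in> G x} \<partial>(measure_pmf p \<bind> K))"
proof -
  let ?R = "measure_pmf p \<bind> K"
  have R: "?R \<in> space (prob_algebra N)"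
    using K by (intro bind_in_space_prob_algebra[where L="count_space UNIV"])
      (auto simp: space_prob_algebra measure_pmf.prob_space_axioms)
  have sets_R [measurable_cong]: "sets ?R = sets N"
    using R by (simp add: space_prob_algebra)
  have "(\<integral>\<^sup>+x. emeasure (K x) (G x) \<partial>measure_pmf p)
      = (\<integral>\<^sup>+x. (\<integral>\<^sup>+y. ennreal (pmf (post y) x) * indicator (G x) y \<partial>?R) \<partial>count_space UNIV)"
    using G by (simp add: nn_integral_measure_pmf post)
  also have "\<dots> = (\<integral>\<^sup>+y. (\<integral>\<^sup>+x. ennreal (pmf (post y) x) * indicator (G x) y \<partial>count_space UNIV) \<partial>?R)"
    by (rule nn_integral_count_space_nn_integral[symmetric])
       (use meas G in \<open>auto simp: measurable_cong_sets[OF sets_R refl]\<close>)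
  also have "\<dots> = (\<integral>\<^sup>+y. emeasure (measure_pmf (post y)) {x. y \<in> G x} \<partial>?R)"
  proof (rule nn_integral_cong)
    fix y
    have "(\<integral>\<^sup>+x. ennreal (pmf (post y) x) * indicator (G x) y \<partial>count_space UNIV)
        = (\<integral>\<^sup>+x. indicator {x. y \<in> G x} x \<partial>measure_pmf (post y))"
      by (subst nn_integral_measure_pmf) (simp add: indicator_def)
    then show "(\<integral>\<^sup>+x. ennreal (pmf (post y) x) * indicator (G x) y \<partial>count_space UNIV)
        = emeasure (measure_pmf (post y)) {x. y \<in> G x}"
      by simp
  qed
  finally show ?thesis .
qed

subsection \<open>Hockey-stick divergence\<close>

text \<open>
  \<open>ennreal\<close> truncates negative reals to \<open>0\<close>, so only the positive parts contribute.
\<close>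

definition hockey_stick :: "real \<Rightarrow> 'a pmf \<Rightarrow> 'a pmf \<Rightarrow> ennreal" where
  "hockey_stick k p r = (\<integral>\<^sup>+x. ennreal (pmf p x - k * pmf r x) \<partial>count_space UNIV)"

lemma borel_measurable_hockey_stick:
  fixes q :: "'b \<Rightarrow> 'a::countable pmf"
  assumes [measurable]: "\<And>x. (\<lambda>y. pmf (q y) x) \<in> borel_measurable N"
  shows "(\<lambda>y. hockey_stick k (q y) r) \<in> borel_measurable N"
  unfolding hockey_stick_def by (rule borel_measurable_nn_integral_count_space) measurable

lemma hockey_stick_le_1: "k \<ge> 0 \<Longrightarrow> hockey_stick k p r \<le> 1"
proof -
  assume "k \<ge> 0"
  then have "hockey_stick k p r \<le> (\<integral>\<^sup>+x. ennreal (pmf p x) \<partial>count_space UNIV)"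
    unfolding hockey_stick_def by (intro nn_integral_mono ennreal_leI) simp
  then show ?thesis
    by (simp add: nn_integral_pmf)
qed

text \<open>Since \<open>f\<close> lies between 0 and 1, \<open>pmf p x * f x\<close> is at most
  \<open>k * pmf r x * f x\<close> plus the positive part of \<open>pmf p x - k * pmf r x\<close>.
  After summation the excess is \<open>k - 1\<close> times the expectation of \<open>f\<close> under
  \<open>r\<close>, hence at most \<open>k - 1\<close>.\<close>

lemma expectation_le_hockey_stick:
  fixes f :: "'a \<Rightarrow> real"
  assumes "k \<ge> 1" and f: "\<And>x. 0 \<le> f x" "\<And>x. f x \<le> 1"
  shows "measure_pmf.expectation p f - measure_pmf.expectation r f
      \<le> k - 1 + enn2real (hockey_stick k p r)"
proof -
  have int: "integrable (measure_pmf s) f" for s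
    using f by (intro measure_pmf.integrable_const_bound[where B=1]) auto
  have E: "(\<integral>\<^sup>+x. ennreal (f x) \<partial>measure_pmf s) = ennreal (measure_pmf.expectation s f)" for s
    using f by (intro nn_integral_eq_integral int) auto
  have E0: "0 \<le> measure_pmf.expectation s f" and E1: "measure_pmf.expectation s f \<le> 1" for s
    using f by (auto intro!: measure_pmf.integral_le_const int)
  have "ennreal (measure_pmf.expectation p f)
      = (\<integral>\<^sup>+x. ennreal (pmf p x) * ennreal (f x) \<partial>count_space UNIV)"
    by (simp add: E[symmetric] nn_integral_measure_pmf)
  also have "\<dots> \<le> (\<integral>\<^sup>+x. ennreal k * (ennreal (pmf r x) * ennreal (f x))
      + ennreal (pmf p x - k * pmf r x) \<partial>count_space UNIV)"
  proof (rule nn_integral_mono)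
    fix x
    have "pmf p x * f x \<le> k * (pmf r x * f x) + max 0 (pmf p x - k * pmf r x)"
    proof -
      have "(pmf p x - k * pmf r x) * f x \<le> max 0 (pmf p x - k * pmf r x) * f x"
        using f by (intro mult_right_mono) auto
      also have "\<dots> \<le> max 0 (pmf p x - k * pmf r x) * 1"
        using f by (intro mult_left_mono) auto
      finally show ?thesis by (simp add: algebra_simps)
    qed
    then have "ennreal (pmf p x * f x)
        \<le> ennreal (k * (pmf r x * f x) + max 0 (pmf p x - k * pmf r x))"
      by (rule ennreal_leI)
    also have "\<dots> = ennreal (k * (pmf r x * f x)) + ennreal (pmf p x - k * pmf r x)"
      using f \<open>k \<ge> 1\<close> by (subst ennreal_plus) (auto simp: max_def ennreal_neg)
    finally show "ennreal (pmf p x) * ennreal (f x) \<le> ennreal k * (ennreal (pmf r x) * ennreal (f x))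
      + ennreal (pmf p x - k * pmf r x)"
      using f \<open>k \<ge> 1\<close> by (simp add: ennreal_mult)
  qed
  also have "\<dots> = ennreal k * ennreal (measure_pmf.expectation r f) + hockey_stick k p r"
    by (simp add: nn_integral_add nn_integral_cmult hockey_stick_def E[symmetric] nn_integral_measure_pmf)
  also have "hockey_stick k p r = ennreal (enn2real (hockey_stick k p r))"
    using hockey_stick_le_1[of k p r] \<open>k \<ge> 1\<close>
    by (intro ennreal_enn2real[symmetric]) (auto intro: le_less_trans simp: less_top[symmetric] top_unique)
  also have "ennreal k * ennreal (measure_pmf.expectation r f) + \<dots>
      = ennreal (k * measure_pmf.expectation r f + enn2real (hockey_stick k p r))"
    using \<open>k \<ge> 1\<close> E0 by (simp add: ennreal_mult)
  finally have "measure_pmf.expectation p f \<le> k * measure_pmf.expectation r f + enn2real (hockey_stick k p r)"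
    using \<open>k \<ge> 1\<close> E0[of r] by (simp add: ennreal_plus[symmetric] del: ennreal_plus)
  moreover have "(k - 1) * measure_pmf.expectation r f \<le> (k - 1) * 1"
    using \<open>k \<ge> 1\<close> E1 by (intro mult_left_mono) auto
  ultimately show ?thesis by (simp add: algebra_simps)
qed

text \<open>Passing from \<open>f\<close> to \<open>1 - f\<close> flips the sign of the difference,
  so one and the same divergence bounds both directions.\<close>

lemma abs_expectation_le_hockey_stick:
  fixes f :: "'a \<Rightarrow> real"
  assumes "k \<ge> 1" and f: "\<And>x. 0 \<le> f x" "\<And>x. f x \<le> 1"
  shows "\<bar>measure_pmf.expectation p f - measure_pmf.expectation r f\<bar>
      \<le> k - 1 + enn2real (hockey_stick k p r)"
proof -
  have int: "integrable (measure_pmf s) f" for s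
    using f by (intro measure_pmf.integrable_const_bound[where B=1]) auto
  have "measure_pmf.expectation p (\<lambda>x. 1 - f x) - measure_pmf.expectation r (\<lambda>x. 1 - f x)
      \<le> k - 1 + enn2real (hockey_stick k p r)"
    using f by (intro expectation_le_hockey_stick \<open>k \<ge> 1\<close>) auto
  with expectation_le_hockey_stick[of k f p r] assms show ?thesis
    by (simp add: int)
qed

text \<open>For fixed \<open>x\<close> the positive part lives on the event where
  \<open>pmf (q y) x\<close> exceeds \<open>k * pmf P x\<close>, and the hypothesis on that single
  event bounds its integral by \<open>pmf P x * \<delta>\<close>. The weights \<open>pmf P x\<close>
  make these errors sum to \<open>\<delta>\<close> over all \<open>x\<close>.\<close>

lemma nn_integral_hockey_stick_le:
  fixes q :: "'b \<Rightarrow> 'a::countable pmf"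
  assumes R: "finite_measure R"
    and meas [measurable]: "\<And>x. (\<lambda>y. pmf (q y) x) \<in> borel_measurable R"
    and k: "k \<ge> 0" and C [measurable]: "C \<in> sets R"
    and le: "\<And>x E. E \<in> sets R \<Longrightarrow> E \<subseteq> C \<Longrightarrow> (\<integral>\<^sup>+y\<in>E. ennreal (pmf (q y) x) \<partial>R)
        \<le> ennreal (pmf P x) * (ennreal k * emeasure R E + ennreal \<delta>)"
  shows "(\<integral>\<^sup>+y\<in>C. hockey_stick k (q y) P \<partial>R) \<le> ennreal \<delta>"
proof -
  interpret R: finite_measure R by fact
  have pointwise: "(\<integral>\<^sup>+y. ennreal (pmf (q y) x - k * pmf P x) * indicator C y \<partial>R) \<le> ennreal (pmf P x) * ennreal \<delta>"
    for x
  proof -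
    define E where "E = {y \<in> space R. y \<in> C \<and> k * pmf P x < pmf (q y) x}"
    have E [measurable]: "E \<in> sets R" unfolding E_def by measurable
    have "E \<subseteq> C" by (auto simp: E_def)
    \<comment> \<open>Adding \<open>?b\<close> to both sides avoids a subtraction of integrals in
      \<open>ennreal\<close>; it can be cancelled at the end because \<open>R\<close> is
      finite.\<close>
    let ?b = "ennreal (pmf P x) * (ennreal k * emeasure R E)"
    have "(\<integral>\<^sup>+y. ennreal (pmf (q y) x - k * pmf P x) * indicator C y \<partial>R) + ?b
       = (\<integral>\<^sup>+y. ennreal (pmf (q y) x - k * pmf P x) * indicator C y + ennreal (pmf P x * k) * indicator E y \<partial>R)"
      using k by (simp add: nn_integral_add nn_integral_cmult ennreal_mult mult.assoc)
    also have "\<dots> = (\<integral>\<^sup>+y\<in>E. ennreal (pmf (q y) x) \<partial>R)"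
      using k by (intro nn_integral_cong)
        (auto simp: E_def indicator_def ennreal_neg ennreal_plus[symmetric] mult.commute simp del: ennreal_plus)
    also have "\<dots> \<le> ennreal (pmf P x) * ennreal \<delta> + ?b"
      using le[OF E \<open>E \<subseteq> C\<close>, of x] by (simp add: distrib_left add.commute)
    finally show ?thesis
      by (simp add: ennreal_mult_eq_top_iff R.emeasure_eq_measure ennreal_add_left_cancel_le
            ennreal_mult[symmetric] k add.commute)
  qed
  have "(\<integral>\<^sup>+y\<in>C. hockey_stick k (q y) P \<partial>R)
      = (\<integral>\<^sup>+y. (\<integral>\<^sup>+x. ennreal (pmf (q y) x - k * pmf P x) * indicator C y \<partial>count_space UNIV) \<partial>R)"
    by (simp add: hockey_stick_def nn_integral_multc)
  also have "\<dots> = (\<integral>\<^sup>+x. (\<integral>\<^sup>+y. ennreal (pmf (q y) x - k * pmf P x) * indicator C y \<partial>R) \<partial>count_space UNIV)"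
    by (rule nn_integral_count_space_nn_integral) auto
  also have "\<dots> \<le> (\<integral>\<^sup>+x. ennreal (pmf P x) * ennreal \<delta> \<partial>count_space UNIV)"
    by (intro nn_integral_mono pointwise)
  also have "\<dots> = ennreal \<delta>"
    by (simp add: nn_integral_multc nn_integral_pmf)
  finally show ?thesis .
qed

subsection \<open>Linear queries on an i.i.d. sample\<close>

lemma map_pmf_iid_sample: "map_pmf (\<lambda>S. S i) (iid_sample P :: ('i::finite \<Rightarrow> 'x) pmf) = P"
  by (simp add: iid_sample_def Pi_pmf_component)

text \<open>By independence, restricting to \<open>S i = x\<close> costs the factor
  \<open>pmf P x\<close> and leaves the law of the other positions alone. Overwriting instead of
  conditioning prepares for privacy: \<open>S(i := x)\<close> and \<open>S\<close> differ only at
  \<open>i\<close>.\<close>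

lemma nn_integral_iid_sample_slice:
  fixes F :: "('i::finite \<Rightarrow> 'x) \<Rightarrow> ennreal"
  shows "(\<integral>\<^sup>+S. F S * indicator {S. S i = x} S \<partial>iid_sample P)
      = ennreal (pmf P x) * (\<integral>\<^sup>+S. F (S(i := x)) \<partial>iid_sample P)"
proof -
  let ?R = "Pi_pmf (UNIV - {i}) undefined (\<lambda>_. P)"
  have iid: "iid_sample P = map_pmf (\<lambda>(y, S). S(i := y)) (pair_pmf P ?R)"
    unfolding iid_sample_def by (subst Pi_pmf_insert[symmetric]) (auto simp: insert_absorb)
  have "(\<integral>\<^sup>+S. F S * indicator {S. S i = x} S \<partial>iid_sample P)
     = (\<integral>\<^sup>+y. \<integral>\<^sup>+S. F (S(i := y)) * indicator {x} y \<partial>?R \<partial>P)"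
    by (simp add: iid nn_integral_pair_pmf' indicator_def)
  also have "\<dots> = (\<integral>\<^sup>+y. (\<integral>\<^sup>+S. F (S(i := x)) \<partial>?R) * indicator {x} y \<partial>P)"
    by (intro nn_integral_cong) (auto simp: indicator_def)
  also have "\<dots> = ennreal (pmf P x) * (\<integral>\<^sup>+S. F (S(i := x)) \<partial>?R)"
    by (simp add: nn_integral_cmult emeasure_pmf_single) (simp add: mult.commute)
  \<comment> \<open>The value at \<open>i\<close> is overwritten anyway, so drawing it as well
    changes nothing.\<close>
  also have "(\<integral>\<^sup>+S. F (S(i := x)) \<partial>?R) = (\<integral>\<^sup>+S. F (S(i := x)) \<partial>iid_sample P)"
    by (simp add: iid nn_integral_pair_pmf')
  finally show ?thesis .
qed

text \<open>Changing a constant dataset at \<open>i\<close> alone keeps all other summands, so an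
  unchanged total forces an unchanged \<open>i\<close>-th summand. This turns dependence of the
  total into information on each component.\<close>

lemma determined_by_query_value_const:
  fixes q :: "('i::finite, 'x) query"
  assumes "determined_by (query_value q) J" "i \<notin> J"
  shows "q i x = q i y"
proof -
  let ?S = "\<lambda>_. x" and ?S' = "(\<lambda>_. x)(i := y)"
  have "query_value q ?S = query_value q ?S'"
    using assms unfolding determined_by_def by (metis fun_upd_other)
  then have "(\<Sum>j\<in>UNIV. q j (?S j)) = (\<Sum>j\<in>UNIV. q j (?S' j))"
    by (simp add: query_value_def)
  moreover have "(\<Sum>j\<in>UNIV. q j (?S j)) = q i x + (\<Sum>j\<in>UNIV - {i}. q j x)"
    by (simp add: sum.remove[of _ i])
  moreover have "(\<Sum>j\<in>UNIV. q j (?S' j)) = q i y + (\<Sum>j\<in>UNIV - {i}. q j x)"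
    by (subst sum.remove[of _ i]) auto
  ultimately show ?thesis by simp
qed

lemma query_value_diff_le:
  fixes q :: "('i::finite, 'x) query"
  assumes "q \<in> linear_queries" "depends_on_at_most m' q"
  shows "query_value q S - query_value q S' \<le> real m' / real CARD('i)"
proof -
  from assms(2) obtain J where J: "card J \<le> m'" "determined_by (query_value q) J"
    by (auto simp: depends_on_at_most_def)
  have q01: "0 \<le> q i x" "q i x \<le> 1" for i x
    using assms(1) by (auto simp: linear_queries_def)
  have "(\<Sum>i\<in>UNIV. q i (S i) - q i (S' i)) \<le> (\<Sum>i\<in>UNIV. indicator J i)"
  proof (rule sum_mono)
    fix i
    show "q i (S i) - q i (S' i) \<le> indicator J i"
      using q01(2)[of i "S i"] q01(1)[of i "S' i"]
        determined_by_query_value_const[OF J(2), of i "S i" "S' i"] by (auto simp: indicator_def)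
  qed
  also have "\<dots> \<le> real m'"
    using J(1) by (simp add: indicator_def of_bool_def sum.If_cases)
  finally show ?thesis
    by (simp add: query_value_def sum_subtractf diff_divide_distrib[symmetric] divide_right_mono)
qed

text \<open>By linearity only the one-position marginals of \<open>r\<close> matter.
  \<open>L\<close> stands for the positions exempt from privacy, each paid for by the trivial bound
  1. The divergences do not involve \<open>q\<close>, so one bound on their sum serves the queries
  of all rounds.\<close>

lemma abs_query_expectation_diff_le:
  fixes q :: "('i::finite, 'x) query" and r :: "('i \<Rightarrow> 'x) pmf"
  assumes "q \<in> linear_queries" "depends_on_at_most m' q" "k \<ge> 1" "card L \<le> \<kappa>"
  shows "\<bar>measure_pmf.expectation r (query_value q) - population_value P q\<bar>
    \<le> real m' / real CARD('i) * (k - 1) + real \<kappa> / real CARD('i)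
      + (\<Sum>i\<in>-L. enn2real (hockey_stick k (map_pmf (\<lambda>S. S i) r) P)) / real CARD('i)"
proof -
  let ?h = "\<lambda>i. enn2real (hockey_stick k (map_pmf (\<lambda>S. S i) r) P)"
  let ?d = "\<lambda>i. measure_pmf.expectation (map_pmf (\<lambda>S. S i) r) (q i) - measure_pmf.expectation P (q i)"
  from assms(2) obtain J where J: "card J \<le> m'" "determined_by (query_value q) J"
    by (auto simp: depends_on_at_most_def)
  have q01: "0 \<le> q i x" "q i x \<le> 1" for i x
    using assms(1) by (auto simp: linear_queries_def)
  have int: "integrable (measure_pmf s) (q i)" for s i
    using q01 by (intro measure_pmf.integrable_const_bound[where B=1]) auto
  have E01: "0 \<le> measure_pmf.expectation s (q i)" "measure_pmf.expectation s (q i) \<le> 1" for s i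
    using q01 by (auto intro!: measure_pmf.integral_le_const int)
  have E: "measure_pmf.expectation s (query_value q)
      = (\<Sum>i\<in>UNIV. measure_pmf.expectation (map_pmf (\<lambda>S. S i) s) (q i)) / real CARD('i)" for s
  proof -
    have "integrable (measure_pmf s) (\<lambda>S. q i (S i))" for i
      using q01 by (intro measure_pmf.integrable_const_bound[where B=1]) auto
    then show ?thesis
      by (simp add: query_value_def[abs_def] Bochner_Integration.integral_sum)
  qed
  have "\<bar>measure_pmf.expectation r (query_value q) - population_value P q\<bar>
      = \<bar>\<Sum>i\<in>UNIV. ?d i\<bar> / real CARD('i)"
    by (simp only: population_value_def E map_pmf_iid_sample sum_subtractf
        diff_divide_distrib[symmetric] abs_divide abs_of_nat)
  also have "\<bar>\<Sum>i\<in>UNIV. ?d i\<bar> \<le> (\<Sum>i\<in>UNIV. \<bar>?d i\<bar>)"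
    by (rule sum_abs)
  also have "\<dots> \<le> (\<Sum>i\<in>UNIV. (k - 1) * indicator J i + indicator L i + ?h i * indicator (-L) i)"
  proof (rule sum_mono)
    fix i
    \<comment> \<open>Components outside \<open>J\<close> are constant and cancel, which is why
      \<open>k - 1\<close> is charged at most \<open>m'\<close> times.\<close>
    consider "i \<notin> J" | "i \<in> L" | "i \<in> J" "i \<notin> L" by blast
    then show "\<bar>?d i\<bar> \<le> (k - 1) * indicator J i + indicator L i + ?h i * indicator (-L) i"
    proof cases
      case 1
      then have const: "q i = (\<lambda>_. q i undefined)"
        using determined_by_query_value_const[OF J(2)] by blast
      have "measure_pmf.expectation s (q i) = q i undefined" for s
        using arg_cong[OF const, of "measure_pmf.expectation s"] by simp
      then have "?d i = 0" by simp
      then show ?thesis using \<open>k \<ge> 1\<close> by (simp add: indicator_def)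
    next
      case 2
      then show ?thesis
        using E01[of "map_pmf (\<lambda>S. S i) r" i] E01[of P i] \<open>k \<ge> 1\<close> by (auto simp: indicator_def)
    next
      case 3
      then show ?thesis
        using abs_expectation_le_hockey_stick[of k "q i" "map_pmf (\<lambda>S. S i) r" P] \<open>k \<ge> 1\<close> q01
        by simp
    qed
  qed
  also have "\<dots> = (k - 1) * real (card J) + real (card L) + (\<Sum>i\<in>-L. ?h i)"
  proof -
    have "(\<Sum>i\<in>UNIV. indicator X i) = real (card X)" for X :: "'i set"
      by (simp add: indicator_def of_bool_def sum.If_cases)
    moreover have "(\<Sum>i\<in>UNIV. ?h i * indicator (-L) i) = (\<Sum>i\<in>-L. ?h i)"
      by (intro sum.mono_neutral_cong_right) (auto simp: indicator_def)
    ultimately show ?thesis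
      by (simp only: sum.distrib sum_distrib_left[symmetric])
  qed
  also have "\<dots> \<le> (k - 1) * real m' + real \<kappa> + (\<Sum>i\<in>-L. ?h i)"
    using J(1) assms by (intro add_mono mult_left_mono) auto
  finally show ?thesis
    by (simp add: divide_right_mono add_divide_distrib[symmetric] mult.commute)
qed

text \<open>
  A probability of \<open>B\<close> below \<open>1\<close> provides a dataset on which the answer is accurate; since the value of
  the query varies by at most \<open>m' / m\<close>, the error on \<open>B\<close> is then bounded as well.
\<close>

lemma abs_diff_query_expectation_le:
  fixes q :: "('i::finite, 'x) query" and r :: "('i \<Rightarrow> 'x) pmf"
  assumes q: "q \<in> linear_queries" "depends_on_at_most m' q"
    and good: "\<And>S. S \<notin> B \<Longrightarrow> \<bar>a - query_value q S\<bar> \<le> \<alpha>"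
    and B: "measure_pmf.prob r B < min 1 c"
  shows "\<bar>a - measure_pmf.expectation r (query_value q)\<bar> \<le> \<alpha> + real m' / real CARD('i) * c"
proof -
  define w where "w = real m' / real CARD('i)"
  have w: "query_value q S - query_value q S' \<le> w" for S S'
    unfolding w_def using q by (rule query_value_diff_le)
  have "w \<ge> 0" by (simp add: w_def)
  have "B \<noteq> UNIV" using B by auto
  then obtain S0 where S0: "S0 \<notin> B" by blast
  have le: "\<bar>a - query_value q S\<bar> \<le> \<alpha> + w * indicator B S" for S
    using good[OF S0] good[of S] w[of S S0] w[of S0 S]
    by (cases "S \<in> B") auto
  have bnd: "\<bar>query_value q S\<bar> \<le> \<bar>a\<bar> + \<bar>\<alpha>\<bar> + w" for S
  proof -
    have "w * indicator B S \<le> w" using \<open>w \<ge> 0\<close> by (simp add: indicator_def)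
    with le[of S] show ?thesis by linarith
  qed
  have int_B: "integrable (measure_pmf r) (\<lambda>S. w * indicator B S)"
    by (rule measure_pmf.integrable_const_bound[where B=w])
      (use \<open>w \<ge> 0\<close> in \<open>auto simp: indicator_def\<close>)
  have int: "integrable (measure_pmf r) (query_value q)"
    using bnd by (intro measure_pmf.integrable_const_bound[where B="\<bar>a\<bar> + \<bar>\<alpha>\<bar> + w"]) auto
  have "\<bar>a - measure_pmf.expectation r (query_value q)\<bar>
      = \<bar>measure_pmf.expectation r (\<lambda>S. a - query_value q S)\<bar>"
    using int by simp
  also have "\<dots> \<le> measure_pmf.expectation r (\<lambda>S. \<bar>a - query_value q S\<bar>)"
    by (rule integral_abs_bound)
  also have "\<dots> \<le> measure_pmf.expectation r (\<lambda>S. \<alpha> + w * indicator B S)"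
    by (rule integral_mono) (use int int_B le in auto)
  also have "\<dots> = \<alpha> + w * measure_pmf.prob r B"
    using int_B by (subst Bochner_Integration.integral_add) auto
  also have "\<dots> \<le> \<alpha> + w * c"
    using B \<open>w \<ge> 0\<close> by (intro add_left_mono mult_left_mono) auto
  finally show ?thesis by (simp only: w_def)
qed

subsection \<open>Interactions\<close>

lemma run_in_prob_algebra:
  assumes M: "is_mechanism Q M" and A: "is_adversary Q T A" and "t \<le> T"
  shows "run Q M A S t \<in> space (prob_algebra (transcript_space Q t \<Otimes>\<^sub>M states M))"
  using \<open>t \<le> T\<close>
proof (induction t)
  case 0
  have "init M S \<in> space (prob_algebra (states M))"
    using M by (auto simp: is_mechanism_def)
  \<comment> \<open>The constant \<open>undefined\<close> function is the only point of the empty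
    product, hence a legitimate empty history.\<close>
  moreover have "(\<lambda>s. return (transcript_space Q 0 \<Otimes>\<^sub>M states M) (\<lambda>_. undefined, s))
      \<in> states M \<rightarrow>\<^sub>M prob_algebra (transcript_space Q 0 \<Otimes>\<^sub>M states M)"
    by (rule measurable_compose[OF _ measurable_return_prob_space], rule measurable_Pair1')
       (simp add: transcript_space_def space_PiM)
  ultimately show ?case
    unfolding run.simps by (rule bind_in_space_prob_algebra)
next
  case (Suc t)
  let ?N = "transcript_space Q t \<Otimes>\<^sub>M states M"
  let ?N' = "transcript_space Q (Suc t) \<Otimes>\<^sub>M states M"
  have resp [measurable]: "(\<lambda>(s, q). respond M s q) \<in>
      states M \<Otimes>\<^sub>M query_space Q \<rightarrow>\<^sub>M prob_algebra (borel \<Otimes>\<^sub>M states M)"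
    using M by (auto simp: is_mechanism_def)
  have [measurable]: "A t \<in> (\<Pi>\<^sub>M j\<in>{..<t}. query_space Q \<Otimes>\<^sub>M borel) \<rightarrow>\<^sub>M prob_algebra (query_space Q)"
    using A Suc.prems by (auto simp: is_adversary_def transcript_space_def)
  have "(\<lambda>(h, s). A t h \<bind> (\<lambda>q. respond M s q \<bind> (\<lambda>(a, s').
          return ?N' (h(t := (q, a)), s')))) \<in> ?N \<rightarrow>\<^sub>M prob_algebra ?N'"
    \<comment> \<open>Rewriting \<open>{..<Suc t}\<close> as \<open>insert t {..<t}\<close> exhibits
      \<open>h(t := (q, a))\<close> as the extension of a product point by one coordinate.\<close>
    unfolding case_prod_beta' transcript_space_def lessThan_Suc by measurable
  then show ?case
    using Suc.IH Suc.prems unfolding run.simps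
    by (intro bind_in_space_prob_algebra) auto
qed

lemma interaction_in_prob_algebra:
  assumes "is_mechanism Q M" "is_adversary Q T A"
  shows "interaction Q T M A S \<in> space (prob_algebra (transcript_space Q T))"
proof -
  let ?R = "run Q M A S T"
  have R: "sets ?R = sets (transcript_space Q T \<Otimes>\<^sub>M states M)" "prob_space ?R"
    using run_in_prob_algebra[OF assms order_refl, of S] by (auto simp: space_prob_algebra)
  have "fst \<in> ?R \<rightarrow>\<^sub>M transcript_space Q T"
    by (simp add: measurable_cong_sets[OF R(1) refl])
  with R(2) show ?thesis
    by (simp add: interaction_def space_prob_algebra prob_space.prob_space_distr)
qed

lemma sample_and_transcript_eq_bind:
  assumes "is_mechanism Q M" "is_adversary Q T A"
  shows "sample_and_transcript Q T M A P = measure_pmf (iid_sample P) \<bind>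
      (\<lambda>S. distr (interaction Q T M A S) (count_space UNIV \<Otimes>\<^sub>M transcript_space Q T) (Pair S))"
  unfolding sample_and_transcript_def
proof (rule bind_cong[OF refl])
  fix S
  have K: "sets (interaction Q T M A S) = sets (transcript_space Q T)" "prob_space (interaction Q T M A S)"
    using interaction_in_prob_algebra[OF assms, of S] by (auto simp: space_prob_algebra)
  then have "space (interaction Q T M A S) \<noteq> {}"
    by (simp add: prob_space.not_empty)
  then show "interaction Q T M A S \<bind> (\<lambda>\<pi>. return (count_space UNIV \<Otimes>\<^sub>M transcript_space Q T) (S, \<pi>))
      = distr (interaction Q T M A S) (count_space UNIV \<Otimes>\<^sub>M transcript_space Q T) (Pair S)"
    by (rule bind_return_distr') (simp add: measurable_cong_sets[OF K(1) refl])
qed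

lemma
  fixes Q :: "('i::finite, 'x::countable) query set"
  assumes MA: "is_mechanism Q M" "is_adversary Q T A"
  shows sample_and_transcript_in_prob_algebra: "sample_and_transcript Q T M A P
      \<in> space (prob_algebra (count_space UNIV \<Otimes>\<^sub>M transcript_space Q T))"
    and emeasure_sample_and_transcript:
      "X \<in> sets (count_space UNIV \<Otimes>\<^sub>M transcript_space Q T) \<Longrightarrow>
       emeasure (sample_and_transcript Q T M A P) X
        = (\<integral>\<^sup>+S. emeasure (interaction Q T M A S) (Pair S -` X) \<partial>iid_sample P)"
proof -
  let ?N = "transcript_space Q T"
  let ?D = "\<lambda>S. distr (interaction Q T M A S) (count_space UNIV \<Otimes>\<^sub>M ?N) (Pair S)"
  have K: "sets (interaction Q T M A S) = sets ?N" "prob_space (interaction Q T M A S)" for S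
    using interaction_in_prob_algebra[OF MA, of S] by (auto simp: space_prob_algebra)
  have Pair: "Pair S \<in> interaction Q T M A S \<rightarrow>\<^sub>M count_space UNIV \<Otimes>\<^sub>M ?N" for S
    by (simp add: measurable_cong_sets[OF K(1) refl])
  \<comment> \<open>The prior carries the discrete sigma-algebra, so only the values of the kernel
    have to be checked.\<close>
  have D: "?D \<in> measure_pmf (iid_sample P) \<rightarrow>\<^sub>M prob_algebra (count_space UNIV \<Otimes>\<^sub>M ?N)"
    using K(2) Pair by (simp add: space_prob_algebra prob_space.prob_space_distr)
  show "sample_and_transcript Q T M A P \<in> space (prob_algebra (count_space UNIV \<Otimes>\<^sub>M ?N))"
    unfolding sample_and_transcript_eq_bind[OF MA] using D
    by (intro bind_in_space_prob_algebra[where L="count_space UNIV"])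
      (auto simp: space_prob_algebra measure_pmf.prob_space_axioms)
  assume X: "X \<in> sets (count_space UNIV \<Otimes>\<^sub>M ?N)"
  have "Pair S -` X \<inter> space ?N = Pair S -` X" for S
    using sets.sets_into_space[OF X] by (auto simp: space_pair_measure)
  then show "emeasure (sample_and_transcript Q T M A P) X
        = (\<integral>\<^sup>+S. emeasure (interaction Q T M A S) (Pair S -` X) \<partial>iid_sample P)"
    unfolding sample_and_transcript_eq_bind[OF MA]
    by (subst emeasure_bind[OF _ measurable_prob_algebraD[OF D] X])
      (simp_all add: emeasure_distr[OF Pair X] sets_eq_imp_space_eq[OF K(1)])
qed

lemma query_value_measurable:
  fixes Q :: "('i::finite, 'x::countable) query set"
  shows "(\<lambda>q. query_value q S) \<in> borel_measurable (query_space Q)"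
proof -
  have "(\<lambda>q. q i (S i)) \<in> borel_measurable (borel :: ('i, 'x) query measure)" for i
    using measurable_compose[OF measurable_product_coordinates[of i] measurable_product_coordinates[of "S i"]] .
  then show ?thesis
    unfolding query_value_def query_space_def
    by (intro measurable_restrict_space1 borel_measurable_divide borel_measurable_sum borel_measurable_const)
qed

lemma sample_error_measurable:
  fixes Q :: "('i::finite, 'x::countable) query set"
  assumes "t < T"
  shows "(\<lambda>\<pi>. \<bar>snd (\<pi> t) - query_value (fst (\<pi> t)) S\<bar>) \<in> borel_measurable (transcript_space Q T)"
proof -
  have [measurable]: "(\<lambda>\<pi>. \<pi> t) \<in> transcript_space Q T \<rightarrow>\<^sub>M query_space Q \<Otimes>\<^sub>M borel"
    unfolding transcript_space_def using assms by (intro measurable_component_singleton) simp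
  note [measurable] = query_value_measurable
  show ?thesis by measurable
qed

text \<open>The left side is the joint probability of \<open>S i = x\<close> and \<open>E\<close>.
  After overwriting position \<open>i\<close> by \<open>x\<close>, privacy compares with the
  unmodified sample, whose average is the marginal law of the transcript. So the joint law is nearly
  dominated by the product of the marginals.\<close>

lemma partial_privacy_pmf_slice:
  fixes Q :: "('i::finite, 'x::countable) query set"
  assumes MA: "is_mechanism Q M" "is_adversary Q T A" and "\<delta> \<ge> 0"
    and E: "E \<in> sets (transcript_space Q T)"
    and dp: "\<And>S S'. differ_only_at i S S' \<Longrightarrow> measure (interaction Q T M A S) E
             \<le> exp \<epsilon> * measure (interaction Q T M A S') E + \<delta>"
  shows "(\<integral>\<^sup>+S. emeasure (interaction Q T M A S) E * indicator {S. S i = x} S \<partial>iid_sample P)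
    \<le> ennreal (pmf P x) * (ennreal (exp \<epsilon>)
        * emeasure (measure_pmf (iid_sample P) \<bind> interaction Q T M A) E + ennreal \<delta>)"
proof -
  let ?K = "interaction Q T M A"
  have K: "prob_space (?K S)" "?K S \<in> space (prob_algebra (transcript_space Q T))" for S
    using interaction_in_prob_algebra[OF MA, of S] by (auto simp: space_prob_algebra)
  have eq: "emeasure (?K S) E = ennreal (measure (?K S) E)" for S
    using K(1)[of S] by (simp add: prob_space_def finite_measure.emeasure_eq_measure)
  have "(\<integral>\<^sup>+S. emeasure (?K (S(i := x))) E \<partial>iid_sample P)
    \<le> (\<integral>\<^sup>+S. ennreal (exp \<epsilon>) * emeasure (?K S) E + ennreal \<delta> \<partial>iid_sample P)"
  proof (rule nn_integral_mono)
    fix S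
    have "measure (?K (S(i := x))) E \<le> exp \<epsilon> * measure (?K S) E + \<delta>"
      by (rule dp) (simp add: differ_only_at_def)
    then have "ennreal (measure (?K (S(i := x))) E) \<le> ennreal (exp \<epsilon> * measure (?K S) E + \<delta>)"
      by (rule ennreal_leI)
    then show "emeasure (?K (S(i := x))) E \<le> ennreal (exp \<epsilon>) * emeasure (?K S) E + ennreal \<delta>"
      using \<open>\<delta> \<ge> 0\<close> by (simp add: eq ennreal_mult)
  qed
  also have "\<dots> = ennreal (exp \<epsilon>) * emeasure (measure_pmf (iid_sample P) \<bind> ?K) E + ennreal \<delta>"
  proof -
    have "?K \<in> measure_pmf (iid_sample P) \<rightarrow>\<^sub>M subprob_algebra (transcript_space Q T)"
      by (rule measurable_prob_algebraD) (use K(2) in simp)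
    then show ?thesis
      using E by (subst emeasure_bind) (auto simp: nn_integral_add nn_integral_cmult)
  qed
  finally show ?thesis
    by (simp add: nn_integral_iid_sample_slice mult_left_mono)
qed

subsection \<open>Generalization\<close>

text \<open>The accuracy term equals \<open>\<beta> / c\<close> for \<open>c \<le> 1\<close>. For
  \<open>c > 1\<close> the term \<open>\<beta> / c\<close> would be too small: on constant queries,
  answers that are exact except for a huge data-independent error with probability
  \<open>\<beta> > 0\<close> are fully private, yet fail with probability
  \<open>\<beta>\<close>.\<close>

theorem theorem4:
  fixes Q :: "('i::finite, 'x::countable) query set"
    and M :: "('i, 'x, 's) mechanism"
    and A :: "('i, 'x) adversary"
    and P :: "'x pmf"
    and T m' \<kappa> :: nat
    and \<epsilon> \<delta> \<alpha> \<beta> c d :: real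
  assumes "T > 0"
    and "is_mechanism Q M"
    and "Q \<subseteq> linear_queries"
    and "\<forall>q\<in>Q. depends_on_at_most m' q"
    and "\<epsilon> \<ge> 0"
    and "partial_differentially_private Q T M \<epsilon> \<delta> \<kappa>"
    and "sample_accurate Q T M \<alpha> \<beta>"
    and "is_adversary Q T A"
    and "c > 0" and "d > 0"
  shows "\<P>((S, \<pi>) in sample_and_transcript Q T M A P.
           (MAX t\<in>{..<T}. \<bar>snd (\<pi> t) - population_value P (fst (\<pi> t))\<bar>)
             > \<alpha> + real m' / real CARD('i) * (exp \<epsilon> - 1 + c) + 2 * real \<kappa> / real CARD('i) + 2 * d)
         \<le> \<delta> / d + \<beta> / min 1 c"
proof -
  note MA = assms(2,8)

  \<comment> \<open>Joint law of dataset and transcript, and the posterior\<close>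
  define N where "N = transcript_space Q T"
  define K where "K = interaction Q T M A"
  define J where "J = sample_and_transcript Q T M A P"
  define p where "p = (iid_sample P :: ('i \<Rightarrow> 'x) pmf)"
  define \<rho> where "\<rho> = measure_pmf p \<bind> K"
  have K: "K S \<in> space (prob_algebra N)" for S
    unfolding K_def N_def by (rule interaction_in_prob_algebra[OF MA])
  have \<rho>: "\<rho> \<in> space (prob_algebra N)"
    unfolding \<rho>_def using K by (intro bind_in_space_prob_algebra[where L="count_space UNIV"])
      (auto simp: space_prob_algebra measure_pmf.prob_space_axioms)
  then interpret R: prob_space \<rho> by (simp add: space_prob_algebra)
  have sets_\<rho> [simp, measurable_cong]: "sets \<rho> = sets N" and space_\<rho> [simp]: "space \<rho> = space N"
    using \<rho> sets_eq_imp_space_eq[of \<rho> N] by (auto simp: space_prob_algebra)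
  have J: "J \<in> space (prob_algebra (count_space UNIV \<Otimes>\<^sub>M N))"
    unfolding J_def N_def by (rule sample_and_transcript_in_prob_algebra[OF MA])
  then interpret J: prob_space J by (simp add: space_prob_algebra)
  have sets_J [simp]: "sets J = sets (count_space UNIV \<Otimes>\<^sub>M N)"
    and space_J: "space J = UNIV \<times> space N"
    using J sets_eq_imp_space_eq[of J "count_space UNIV \<Otimes>\<^sub>M N"]
    by (auto simp: space_prob_algebra space_pair_measure)
  have emeasure_J: "emeasure J X = (\<integral>\<^sup>+S. emeasure (K S) (Pair S -` X) \<partial>p)" if "X \<in> sets J" for X
    using emeasure_sample_and_transcript[OF MA, of X P] that unfolding sets_J by (simp only: J_def N_def K_def p_def)
  obtain post where post_meas [measurable]: "\<And>S. (\<lambda>\<pi>. pmf (post \<pi>) S) \<in> borel_measurable N"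
    and post: "\<And>S B. B \<in> sets N \<Longrightarrow> ennreal (pmf p S) * emeasure (K S) B
        = (\<integral>\<^sup>+\<pi>\<in>B. ennreal (pmf (post \<pi>) S) \<partial>(measure_pmf p \<bind> K))"
    by (rule posterior_exists[where K=K and N=N and p=p, OF K]) (rule that)
  have bayes: "(\<integral>\<^sup>+S. emeasure (K S) (G S) \<partial>p) = (\<integral>\<^sup>+\<pi>. emeasure (measure_pmf (post \<pi>)) {S. \<pi> \<in> G S} \<partial>\<rho>)"
    if "\<And>S. G S \<in> sets N" for G
    unfolding \<rho>_def using K post_meas post that by (rule posterior_joint)
  note post_prob_meas = borel_measurable_emeasure_pmf_section[OF post_meas]

  \<comment> \<open>Privacy guarantee and exempt positions\<close>
  obtain L :: "('i, 'x) transcript \<Rightarrow> 'i set" where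
    L [measurable]: "L \<in> N \<rightarrow>\<^sub>M count_space UNIV" and card_L: "\<And>\<pi>. \<pi> \<in> space N \<Longrightarrow> card (L \<pi>) \<le> \<kappa>"
    and dp_all: "\<forall>A i S S' E. is_adversary Q T A \<longrightarrow> differ_only_at i S S' \<longrightarrow>
      E \<in> sets N \<longrightarrow> i \<notin> (\<Union>\<pi>\<in>E. L \<pi>) \<longrightarrow>
      measure (interaction Q T M A S) E \<le> exp \<epsilon> * measure (interaction Q T M A S') E + \<delta>"
    using assms(6) unfolding partial_differentially_private_def N_def[symmetric] by auto
  have dp: "measure (K S) E \<le> exp \<epsilon> * measure (K S') E + \<delta>"
    if "differ_only_at i S S'" "E \<in> sets N" "i \<notin> (\<Union>\<pi>\<in>E. L \<pi>)" for i S S' E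
    using dp_all[rule_format, OF assms(8) that] by (simp only: K_def)
  \<comment> \<open>Privacy applied to the empty event.\<close>
  have "\<delta> \<ge> 0"
    using dp[of undefined undefined undefined "{}"] by (simp add: differ_only_at_def)

  \<comment> \<open>Posterior probability of a sample error\<close>
  have acc: "\<P>((S, \<pi>) in J. (MAX t\<in>{..<T}. \<bar>snd (\<pi> t) - query_value (fst (\<pi> t)) S\<bar>) \<ge> \<alpha>) \<le> \<beta>"
    unfolding J_def by (rule assms(7)[unfolded sample_accurate_def, rule_format, OF assms(8)])
  then have "\<beta> \<ge> 0"
    using measure_nonneg order_trans by blast
  define bad where "bad S = {\<pi> \<in> space N. (MAX t\<in>{..<T}. \<bar>snd (\<pi> t) - query_value (fst (\<pi> t)) S\<bar>) \<ge> \<alpha>}" for S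
  have bad_sets [measurable]: "bad S \<in> sets N" for S
  proof -
    have "(\<lambda>\<pi>. MAX t\<in>{..<T}. \<bar>snd (\<pi> t) - query_value (fst (\<pi> t)) S\<bar>) \<in> borel_measurable N"
      unfolding N_def by (intro borel_measurable_Max sample_error_measurable) auto
    then show ?thesis unfolding bad_def by measurable
  qed
  define e where "e \<pi> = emeasure (measure_pmf (post \<pi>)) {S. \<pi> \<in> bad S}" for \<pi>
  have e_meas [measurable]: "e \<in> borel_measurable N"
    unfolding e_def by (rule post_prob_meas) simp
  have e_le: "(\<integral>\<^sup>+\<pi>. e \<pi> \<partial>\<rho>) \<le> ennreal \<beta>"
  proof -
    let ?X = "{x \<in> space J. case x of (S, \<pi>) \<Rightarrow>
      (MAX t\<in>{..<T}. \<bar>snd (\<pi> t) - query_value (fst (\<pi> t)) S\<bar>) \<ge> \<alpha>}"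
    have X: "?X = (\<Union>S. {S} \<times> bad S)"
      by (auto simp: space_J bad_def)
    \<comment> \<open>There are only countably many datasets, so a union of measurable slices is
      measurable.\<close>
    have "(\<Union>S. {S} \<times> bad S) \<in> sets (count_space UNIV \<Otimes>\<^sub>M N)"
      by (intro sets.countable_UN') auto
    then have "emeasure J ?X = (\<integral>\<^sup>+\<pi>. e \<pi> \<partial>\<rho>)"
      unfolding X e_def by (subst emeasure_J) (auto simp: bayes[symmetric] vimage_def)
    moreover have "emeasure J ?X \<le> ennreal \<beta>"
      using acc by (simp add: J.emeasure_eq_measure case_prod_beta' ennreal_leI)
    ultimately show ?thesis
      by (simp only:)
  qed

  \<comment> \<open>Divergence of the posterior marginals from \<open>P\<close>\<close>
  define h where "h i \<pi> = hockey_stick (exp \<epsilon>) (map_pmf (\<lambda>S. S i) (post \<pi>)) P" for i \<pi>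
  define W where "W \<pi> = (\<Sum>i\<in>UNIV. h i \<pi> * indicator {\<pi> \<in> space N. i \<notin> L \<pi>} \<pi>)" for \<pi>
  \<comment> \<open>The \<open>if\<close> writes a marginal mass restricted to \<open>E\<close> as
    the posterior probability of a transcript-dependent event, the shape required by
    \<open>bayes\<close> and \<open>post_prob_meas\<close>.\<close>
  have marg: "ennreal (pmf (map_pmf (\<lambda>S. S i) (post \<pi>)) x) * indicator E \<pi>
      = emeasure (measure_pmf (post \<pi>)) {S. \<pi> \<in> (if S i = x then E else {})}" for i x E \<pi>
    by (auto simp: emeasure_pmf_single[symmetric] vimage_def indicator_def)
  have marg_meas [measurable]: "(\<lambda>\<pi>. pmf (map_pmf (\<lambda>S. S i) (post \<pi>)) x) \<in> borel_measurable N" for i x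
  proof -
    have "(\<lambda>\<pi>. ennreal (pmf (map_pmf (\<lambda>S. S i) (post \<pi>)) x) * indicator (space N) \<pi>) \<in> borel_measurable N"
      unfolding marg by (rule post_prob_meas) simp
    then have "(\<lambda>\<pi>. enn2real (ennreal (pmf (map_pmf (\<lambda>S. S i) (post \<pi>)) x) * indicator (space N) \<pi>)) \<in> borel_measurable N"
      by measurable
    then show ?thesis
      by (subst measurable_cong) auto
  qed
  have h_meas [measurable]: "h i \<in> borel_measurable N" for i
    unfolding h_def by (rule borel_measurable_hockey_stick) measurable
  have W_meas [measurable]: "W \<in> borel_measurable N"
    unfolding W_def by measurable
  have h_le: "(\<integral>\<^sup>+\<pi>\<in>{\<pi> \<in> space N. i \<notin> L \<pi>}. h i \<pi> \<partial>\<rho>) \<le> ennreal \<delta>" for i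
    unfolding h_def
  proof (rule nn_integral_hockey_stick_le)
    \<comment> \<open>The measurable subsets of this set are exactly the events to which privacy at
      position \<open>i\<close> applies.\<close>
    fix x E assume E: "E \<in> sets \<rho>" "E \<subseteq> {\<pi> \<in> space N. i \<notin> L \<pi>}"
    have "(\<integral>\<^sup>+\<pi>\<in>E. ennreal (pmf (map_pmf (\<lambda>S. S i) (post \<pi>)) x) \<partial>\<rho>)
      = (\<integral>\<^sup>+S. emeasure (K S) (if S i = x then E else {}) \<partial>p)"
      unfolding marg using E by (subst bayes) auto
    also have "\<dots> = (\<integral>\<^sup>+S. emeasure (K S) E * indicator {S. S i = x} S \<partial>p)"
      by (intro nn_integral_cong) auto
    also have "\<dots> \<le> ennreal (pmf P x) * (ennreal (exp \<epsilon>) * emeasure \<rho> E + ennreal \<delta>)"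
    proof -
      have EN: "E \<in> sets N" and "i \<notin> (\<Union>\<pi>\<in>E. L \<pi>)"
        using E by auto
      from dp[OF _ this] show ?thesis
        unfolding \<rho>_def p_def K_def using EN unfolding N_def
        by (intro partial_privacy_pmf_slice[OF MA \<open>\<delta> \<ge> 0\<close>])
    qed
    finally show "(\<integral>\<^sup>+\<pi>\<in>E. ennreal (pmf (map_pmf (\<lambda>S. S i) (post \<pi>)) x) \<partial>\<rho>)
      \<le> ennreal (pmf P x) * (ennreal (exp \<epsilon>) * emeasure \<rho> E + ennreal \<delta>)" .
  qed (auto simp: R.finite_measure_axioms)
  have W_le: "(\<integral>\<^sup>+\<pi>. W \<pi> \<partial>\<rho>) \<le> ennreal (real CARD('i) * \<delta>)"
  proof -
    have "(\<integral>\<^sup>+\<pi>. W \<pi> \<partial>\<rho>) = (\<Sum>i\<in>UNIV. \<integral>\<^sup>+\<pi>\<in>{\<pi> \<in> space N. i \<notin> L \<pi>}. h i \<pi> \<partial>\<rho>)"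
      unfolding W_def by (rule nn_integral_sum) measurable
    also have "\<dots> \<le> (\<Sum>i\<in>(UNIV::'i set). ennreal \<delta>)"
      by (intro sum_mono h_le)
    also have "\<dots> = ennreal (real CARD('i) * \<delta>)"
      using \<open>\<delta> \<ge> 0\<close> by (simp add: ennreal_mult ennreal_of_nat_eq_real_of_nat)
    finally show ?thesis .
  qed

  \<comment> \<open>Exceptional transcripts and the union bound\<close>
  define m where "m = real CARD('i)"
  have "m > 0" by (simp add: m_def)
  \<comment> \<open>Staying below 1 guarantees that some dataset is accurate for the transcript;
    staying below \<open>c\<close> gives the term \<open>m' / m * c\<close>.\<close>
  define G1 where "G1 = {\<pi> \<in> space N. ennreal (min 1 c) \<le> e \<pi>}"
  \<comment> \<open>\<open>W\<close> sums over \<open>m\<close> positions and has mean at most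
    \<open>m * \<delta>\<close>, so the threshold \<open>m * d\<close> yields
    \<open>\<delta> / d\<close> by Markov.\<close>
  define G2 where "G2 = {\<pi> \<in> space N. ennreal (m * d) \<le> W \<pi>}"
  have [measurable]: "G1 \<in> sets N" "G2 \<in> sets N"
    unfolding G1_def G2_def by measurable
  let ?Y = "{x \<in> space J. case x of (S, \<pi>) \<Rightarrow>
      (MAX t\<in>{..<T}. \<bar>snd (\<pi> t) - population_value P (fst (\<pi> t))\<bar>)
             > \<alpha> + real m' / real CARD('i) * (exp \<epsilon> - 1 + c) + 2 * real \<kappa> / real CARD('i) + 2 * d}"
  have "\<pi> \<in> G1 \<union> G2" if \<pi>: "\<pi> \<in> space N"
    and far: "(MAX t\<in>{..<T}. \<bar>snd (\<pi> t) - population_value P (fst (\<pi> t))\<bar>)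
             > \<alpha> + real m' / real CARD('i) * (exp \<epsilon> - 1 + c) + 2 * real \<kappa> / real CARD('i) + 2 * d" for \<pi>
  proof (rule ccontr)
    assume notG: "\<pi> \<notin> G1 \<union> G2"
    let ?r = "post \<pi>"
    from notG \<pi> have "e \<pi> < ennreal (min 1 c)" by (auto simp: G1_def not_le)
    then have e: "measure_pmf.prob ?r {S. \<pi> \<in> bad S} < min 1 c"
      using \<open>c > 0\<close> by (simp add: e_def measure_pmf.emeasure_eq_measure ennreal_less_iff)
    from notG \<pi> have W: "W \<pi> < ennreal (m * d)" by (auto simp: G2_def not_le)
    have hsum: "(\<Sum>i\<in>-L \<pi>. enn2real (h i \<pi>)) \<le> m * d"
    proof -
      have fin: "ennreal (enn2real (h i \<pi>)) = h i \<pi>" for i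
        using hockey_stick_le_1[of "exp \<epsilon>" "map_pmf (\<lambda>S. S i) ?r" P] unfolding h_def
        by (intro ennreal_enn2real) (auto intro: le_less_trans)
      have "ennreal (\<Sum>i\<in>-L \<pi>. enn2real (h i \<pi>)) = (\<Sum>i\<in>-L \<pi>. h i \<pi>)"
        by (subst sum_ennreal[symmetric]) (auto simp: fin)
      also have "\<dots> = W \<pi>"
        unfolding W_def using \<pi> by (intro sum.mono_neutral_cong_left) (auto simp: indicator_def)
      finally show ?thesis
        using W \<open>m > 0\<close> \<open>d > 0\<close> by (metis ennreal_le_iff less_imp_le mult_pos_pos)
    qed
    obtain t where t: "t < T" "\<bar>snd (\<pi> t) - population_value P (fst (\<pi> t))\<bar>
             > \<alpha> + real m' / m * (exp \<epsilon> - 1 + c) + 2 * real \<kappa> / m + 2 * d"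
      using far \<open>T > 0\<close> unfolding m_def by (subst (asm) Max_gr_iff) auto
    have "fst (\<pi> t) \<in> Q"
      using \<pi> t(1) by (auto simp: N_def transcript_space_def space_PiM space_pair_measure
          query_space_def space_restrict_space PiE_iff mem_Times_iff)
    then have q: "fst (\<pi> t) \<in> linear_queries" "depends_on_at_most m' (fst (\<pi> t))"
      using assms by auto
    have good: "\<bar>snd (\<pi> t) - query_value (fst (\<pi> t)) S\<bar> \<le> \<alpha>" if "S \<notin> {S. \<pi> \<in> bad S}" for S
    proof -
      have "(MAX t\<in>{..<T}. \<bar>snd (\<pi> t) - query_value (fst (\<pi> t)) S\<bar>) < \<alpha>"
        using that \<pi> by (auto simp: bad_def not_le)
      then show ?thesis
        using t(1) by (subst (asm) Max_less_iff) (auto intro: less_imp_le)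
    qed
    have 1: "\<bar>snd (\<pi> t) - measure_pmf.expectation ?r (query_value (fst (\<pi> t)))\<bar> \<le> \<alpha> + real m' / m * c"
      unfolding m_def using q good e by (rule abs_diff_query_expectation_le)
    have 2: "\<bar>measure_pmf.expectation ?r (query_value (fst (\<pi> t))) - population_value P (fst (\<pi> t))\<bar>
      \<le> real m' / m * (exp \<epsilon> - 1) + real \<kappa> / m + (\<Sum>i\<in>-L \<pi>. enn2real (h i \<pi>)) / m"
      unfolding m_def h_def using q \<open>\<epsilon> \<ge> 0\<close> card_L[OF \<pi>] by (intro abs_query_expectation_diff_le) auto
    have 3: "(\<Sum>i\<in>-L \<pi>. enn2real (h i \<pi>)) / m \<le> d"
      using hsum \<open>m > 0\<close> by (simp add: field_simps)
    \<comment> \<open>The bounds 1 to 3 add up to single terms \<open>\<kappa> / m\<close> and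
      \<open>d\<close>; as both are nonnegative, the doubled terms in \<open>t(2)\<close> are
      contradicted.\<close>
    have "0 \<le> real \<kappa> / m" using \<open>m > 0\<close> by simp
    moreover have "real m' / m * (exp \<epsilon> - 1 + c) = real m' / m * (exp \<epsilon> - 1) + real m' / m * c"
      by (simp add: distrib_left)
    moreover have "2 * real \<kappa> / m = real \<kappa> / m + real \<kappa> / m" by simp
    ultimately show False
      using t(2) 1 2 3 \<open>d > 0\<close> by linarith
  qed
  \<comment> \<open>Monotonicity of the measure asks for measurability of the larger set only;
    \<open>?Y\<close> itself is never shown to be measurable.\<close>
  then have "?Y \<subseteq> UNIV \<times> (G1 \<union> G2)"
    by (auto simp: space_J)
  moreover have UG: "UNIV \<times> (G1 \<union> G2) \<in> sets J" by simp
  ultimately have "measure J ?Y \<le> measure J (UNIV \<times> (G1 \<union> G2))"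
    by (intro J.finite_measure_mono)
  also have "\<dots> = measure \<rho> (G1 \<union> G2)"
  proof -
    have "emeasure J (UNIV \<times> (G1 \<union> G2)) = (\<integral>\<^sup>+S. emeasure (K S) (G1 \<union> G2) \<partial>p)"
      by (subst emeasure_J[OF UG]) (simp add: vimage_def Un_def)
    also have "\<dots> = emeasure \<rho> (G1 \<union> G2)"
    proof -
      have "K \<in> measure_pmf p \<rightarrow>\<^sub>M subprob_algebra N"
        by (rule measurable_prob_algebraD) (use K in simp)
      then show ?thesis
        unfolding \<rho>_def by (subst emeasure_bind) auto
    qed
    finally show ?thesis by (simp add: measure_def)
  qed
  also have "\<dots> \<le> measure \<rho> G1 + measure \<rho> G2"
    by (rule measure_Un_le) auto
  also have "\<dots> \<le> \<beta> / min 1 c + m * \<delta> / (m * d)"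
  proof (rule add_mono)
    show "measure \<rho> G1 \<le> \<beta> / min 1 c"
      unfolding G1_def space_\<rho>[symmetric] using e_meas e_le \<open>c > 0\<close> \<open>\<beta> \<ge> 0\<close>
      by (intro R.measure_markov) (auto simp: measurable_cong_sets[OF sets_\<rho> refl])
    show "measure \<rho> G2 \<le> m * \<delta> / (m * d)"
      unfolding G2_def space_\<rho>[symmetric] using W_meas W_le \<open>m > 0\<close> \<open>d > 0\<close> \<open>\<delta> \<ge> 0\<close>
      by (intro R.measure_markov) (auto simp: m_def measurable_cong_sets[OF sets_\<rho> refl])
  qed
  also have "\<dots> = \<delta> / d + \<beta> / min 1 c"
    using \<open>m > 0\<close> by simp
  finally show ?thesis
    by (simp add: J_def case_prod_beta')
qed

end
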